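(* Let $p$ be a prime and let $\xi$ be a $\mathbb{Z}$-valued random variable with $0<\mathbb{P}(p\mid\xi)<1$. For each $n\ge1$, let $L_n$ be an $n\times n$ random lower triangular matrix whose entries on and below the diagonal are i.i.d. copies of $\xi$ (and whose entries above the diagonal are $0$). Then the limit $$\chi_0=\lim_{n\to\infty}\mathbb{E}\left|\{v\in\mathbb{F}_p^n : v_1\neq0,\ L_nv=0\}\right|$$ exists. Moreover, $0<\chi_0<\infty$.
   Context: The equation $L_nv=0$ for $v\in\mathbb{F}_p^n$ is understood with the entries of $L_n$ reduced mod $p$. *)

theory Defs
  imports "HOL-Probability.Probability" "HOL-Number_Theory.Residues"
begin

text \<open>
  The field with \<open>p\<close> elements is \<open>residue_ring (int p)\<close>, with carrier \<open>{0..int p - 1}\<close>.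
  Vectors of length \<open>n\<close> over it are extensional functions on \<open>{1..n}\<close>, so that
  distinct functions are distinct vectors and cardinalities are the intended ones.
\<close>

definition Fp_vecs :: "nat \<Rightarrow> nat \<Rightarrow> (nat \<Rightarrow> int) set" where
  "Fp_vecs p n = {1..n} \<rightarrow>\<^sub>E carrier (residue_ring (int p))"

definition Fp_zero_vec :: "nat \<Rightarrow> nat \<Rightarrow> nat \<Rightarrow> int" where
  "Fp_zero_vec p n = (\<lambda>i\<in>{1..n}. \<zero>\<^bsub>residue_ring (int p)\<^esub>)"

text \<open>
  An \<open>n \<times> n\<close> integer matrix is given by its entries \<open>A i j\<close> with \<open>i, j \<in> {1..n}\<close>;
  they are reduced modulo \<open>p\<close> before multiplying.
\<close>

definition Fp_mat_vec :: "nat \<Rightarrow> nat \<Rightarrow> (nat \<Rightarrow> nat \<Rightarrow> int) \<Rightarrow> (nat \<Rightarrow> int) \<Rightarrow> nat \<Rightarrow> int" where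
  "Fp_mat_vec p n A v = (\<lambda>i\<in>{1..n}.
     finsum (residue_ring (int p))
       (\<lambda>j. (A i j mod int p) \<otimes>\<^bsub>residue_ring (int p)\<^esub> v j) {1..n})"

definition iid_lower_triangular ::
  "'b measure \<Rightarrow> int measure \<Rightarrow> nat \<Rightarrow> ('b \<Rightarrow> nat \<Rightarrow> nat \<Rightarrow> int) \<Rightarrow> bool" where
  "iid_lower_triangular N D n L \<longleftrightarrow>
     prob_space.indep_vars N (\<lambda>_. count_space UNIV) (\<lambda>(i, j) \<omega>. L \<omega> i j)
       {(i, j). 1 \<le> j \<and> j \<le> i \<and> i \<le> n} \<and>
     (\<forall>i j. 1 \<le> j \<and> j \<le> i \<and> i \<le> n \<longrightarrow>
        distr N (count_space UNIV) (\<lambda>\<omega>. L \<omega> i j) = D) \<and>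
     (\<forall>\<omega>\<in>space N. \<forall>i j. 1 \<le> i \<and> i < j \<and> j \<le> n \<longrightarrow> L \<omega> i j = 0)"

end

theory Submission imports Defs "HOL-Library.Real_Mod" begin

text \<open>
  Write \<open>\<mu>\<close> for the law of \<open>\<xi>\<close> modulo \<open>p\<close>. Because the rows of \<open>L\<^sub>n\<close> are independent and the \<open>i\<close>-th row
  only sees \<open>v\<^sub>1, \<dots>, v\<^sub>i\<close>, a fixed vector \<open>v\<close> lies in the kernel with probability
  \<open>W\<^sub>n(v) = P\<^sub>1(v) \<cdots> P\<^sub>n(v)\<close>, where \<open>P\<^sub>i(v)\<close> is the probability that
  \<open>\<xi>\<^sub>1 v\<^sub>1 + \<dots> + \<xi>\<^sub>i v\<^sub>i\<close> vanishes modulo \<open>p\<close>. The expectation is thus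
  \<open>E\<^sub>n = \<Sum>\<^sub>v W\<^sub>n(v)\<close>, the sum being over all \<open>v\<close> with \<open>v\<^sub>1 \<noteq> 0\<close> (\<open>expected_kernel_card\<close>).

  Now let \<open>v\<close> grow by one coordinate \<open>x\<close>. For a nonzero residue \<open>a\<close> of the new matrix entry the
  product \<open>a x\<close> is uniform as \<open>x\<close> runs through the field, and for \<open>a = 0\<close> the new coordinate is
  invisible; hence \<open>\<Sum>\<^sub>x P\<^sub>n\<^sub>+\<^sub>1(v, x) = 1 + \<mu>(0) (p P\<^sub>n(v) - 1)\<close> (\<open>sum_row_prob_append\<close>), and
  \<open>E\<^sub>n\<^sub>+\<^sub>1 - E\<^sub>n = \<mu>(0) \<Sum>\<^sub>v W\<^sub>n(v) (p P\<^sub>n(v) - 1)\<close>.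

  The hypothesis \<open>0 < \<mu>(0) < 1\<close> makes every nontrivial Fourier coefficient of \<open>\<mu>\<close> strictly smaller
  than 1 in modulus, so \<open>p P\<^sub>n(v) - 1\<close> is exponentially small in the number of nonzero entries of \<open>v\<close>
  (\<open>row_prob_bound\<close>). It remains to see that vectors with few nonzero entries carry little of the mass
  \<open>W\<^sub>n\<close>. This is done with a Lyapunov function: there is a positive \<open>g\<close>, dominating \<open>\<bar>p P\<^sub>n - 1\<bar>\<close> up
  to a constant and tending to 0, such that \<open>\<Sum>\<^sub>v W\<^sub>n(v) g(|v|)\<close> shrinks by a factor \<open>\<theta> < 1\<close> in every
  step (\<open>contracting_potential\<close>); here \<open>|v|\<close> is the number of nonzero entries. So the differences
  \<open>E\<^sub>n\<^sub>+\<^sub>1 - E\<^sub>n\<close> are dominated by a geometric series, and \<open>E\<^sub>n\<close> converges.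

  The same estimate gives positivity. For a suitable constant \<open>D\<close> the sum of \<open>W\<^sub>n(v) (1 - D g(|v|))\<close>
  over all \<open>v\<close> with a prescribed nonzero prefix is nondecreasing in \<open>n\<close>. If the prefix is a long block of ones,
  this sum starts with a positive value, which is then a lower bound for all later \<open>E\<^sub>n\<close>.
\<close>

section \<open>Strict convexity and sums over vectors\<close>

text \<open>
  The strict triangle inequality, in the form that bounds Fourier coefficients: two masses at different
  points of the unit circle do not align.
\<close>

lemma norm_convex_combination_less_sum:
  fixes a b :: real and z :: complex
  assumes "0 < a" "0 < b" "norm z = 1" "z \<noteq> 1"
  shows "norm (of_real a + of_real b * z) < a + b"
proof -
  have n: "(Re z)\<^sup>2 + (Im z)\<^sup>2 = 1"
    using assms(3) by (simp add: cmod_def)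
  have "Re z \<noteq> 1"
    using n assms(4) by (auto simp: complex_eq_iff)
  moreover have "Re z \<le> 1"
    using complex_Re_le_cmod[of z] assms(3) by simp
  ultimately have re: "Re z < 1" by simp
  have "(norm (of_real a + of_real b * z))\<^sup>2 = (a + b * Re z)\<^sup>2 + (b * Im z)\<^sup>2"
    by (simp add: cmod_power2)
  also have "\<dots> = a\<^sup>2 + b\<^sup>2 * ((Re z)\<^sup>2 + (Im z)\<^sup>2) + 2 * a * b * Re z"
    by (simp add: power2_eq_square algebra_simps)
  also have "\<dots> < a\<^sup>2 + b\<^sup>2 + 2 * a * b"
    using n re assms(1,2) by simp
  also have "\<dots> = (a + b)\<^sup>2"
    by (simp add: power2_eq_square algebra_simps)
  finally show ?thesis
    by (rule power2_less_imp_less) (use assms(1,2) in simp)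
qed

text \<open>
  A vector of length \<open>n + 1\<close> is a vector of length \<open>n\<close> followed by one more entry. The side condition \<open>Q\<close>
  may be any constraint on the entries already present.
\<close>

lemma sum_Fp_vecs_Suc:
  fixes F :: "(nat \<Rightarrow> int) \<Rightarrow> real"
  assumes Q: "\<And>v x. v \<in> Fp_vecs p n \<Longrightarrow> x \<in> {0..<int p} \<Longrightarrow> Q (v(Suc n := x)) \<longleftrightarrow> Q v"
  shows "(\<Sum>v | v \<in> Fp_vecs p (Suc n) \<and> Q v. F v)
       = (\<Sum>v | v \<in> Fp_vecs p n \<and> Q v. \<Sum>x\<in>{0..<int p}. F (v(Suc n := x)))"
proof -
  have carr: "carrier (residue_ring (int p)) = {0..<int p}"
    by (auto simp: residue_ring_def)
  have V: "Fp_vecs p m = {1..m} \<rightarrow>\<^sub>E {0..<int p}" for m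
    by (simp add: Fp_vecs_def carr)
  have ins: "{1..Suc n} = insert (Suc n) {1..n}" by auto
  have inj: "inj_on (\<lambda>(v, x). v(Suc n := x)) ({v \<in> Fp_vecs p n. Q v} \<times> {0..<int p})"
  proof (intro inj_onI, clarsimp)
    fix v x w y
    assume v: "v \<in> Fp_vecs p n" and w: "w \<in> Fp_vecs p n"
      and eq: "v(Suc n := x) = w(Suc n := y)"
    have "v (Suc n) = w (Suc n)"
      using v w by (auto simp: V PiE_def extensional_def)
    then show "v = w \<and> x = y"
      using eq by (metis fun_upd_same fun_upd_triv fun_upd_upd)
  qed
  have im: "(\<lambda>(v, x). v(Suc n := x)) ` ({v \<in> Fp_vecs p n. Q v} \<times> {0..<int p})
      = {v \<in> Fp_vecs p (Suc n). Q v}" (is "?l = ?r")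
  proof
    show "?l \<subseteq> ?r"
      using Q by (auto simp: V PiE_iff extensional_def)
    show "?r \<subseteq> ?l"
    proof
      fix u assume u: "u \<in> ?r"
      define v where "v = u(Suc n := undefined)"
      have v: "v \<in> Fp_vecs p n"
        using u by (auto simp: v_def V PiE_iff extensional_def)
      have x: "u (Suc n) \<in> {0..<int p}"
        using u by (auto simp: V PiE_iff)
      have uv: "u = v(Suc n := u (Suc n))" by (simp add: v_def)
      have "Q v" using Q[OF v x] u uv by simp
      then show "u \<in> ?l"
        using v x uv by (intro image_eqI[of _ _ "(v, u (Suc n))"]) auto
    qed
  qed
  have "(\<Sum>v | v \<in> Fp_vecs p (Suc n) \<and> Q v. F v)
      = (\<Sum>(v, x)\<in>{v \<in> Fp_vecs p n. Q v} \<times> {0..<int p}. F (v(Suc n := x)))"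
    unfolding im[symmetric] by (subst sum.reindex[OF inj]) (simp add: case_prod_unfold o_def)
  also have "\<dots> = (\<Sum>v | v \<in> Fp_vecs p n \<and> Q v. \<Sum>x\<in>{0..<int p}. F (v(Suc n := x)))"
    by (simp add: sum.cartesian_product)
  finally show ?thesis .
qed

lemma Fp_vecs_range: "v \<in> Fp_vecs p n \<Longrightarrow> j \<in> {1..n} \<Longrightarrow> v j \<in> {0..<int p}"
  by (auto simp: Fp_vecs_def residue_ring_def PiE_iff Pi_iff)

lemma finite_Fp_vecs: "finite (Fp_vecs p n)"
  unfolding Fp_vecs_def by (intro finite_PiE) (auto simp: residue_ring_def)

section \<open>Fourier coefficients of a law on residues\<close>

locale residue_distribution =
  fixes p :: nat and \<mu> :: "int \<Rightarrow> real"
  assumes prime_p: "prime p"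
    and mu_nonneg: "0 \<le> \<mu> a"
    and mu_sum: "(\<Sum>a\<in>{0..<int p}. \<mu> a) = 1"
    and mu0_pos: "0 < \<mu> 0"
    and mu0_less: "\<mu> 0 < 1"
begin

lemma p_gt_1: "1 < p"
  using prime_p prime_gt_1_nat by blast

definition additive_char :: "int \<Rightarrow> complex" where
  "additive_char k = cis (2 * pi * of_int k / of_nat p)"

lemma additive_char_0 [simp]: "additive_char 0 = 1"
  by (simp add: additive_char_def)

lemma additive_char_add: "additive_char (k + l) = additive_char k * additive_char l"
  by (simp add: additive_char_def cis_mult ring_distribs add_divide_distrib)

lemma norm_additive_char [simp]: "norm (additive_char k) = 1"
  by (simp add: additive_char_def)

lemma additive_char_of_nat_mult: "additive_char (k * int n) = additive_char k ^ n"
  by (induction n) (simp_all add: additive_char_add ring_distribs)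

lemma additive_char_eq_1_iff: "additive_char k = 1 \<longleftrightarrow> int p dvd k"
proof -
  have "additive_char k = 1 \<longleftrightarrow> (\<exists>n. 2 * pi * of_int k / of_nat p = of_int n * (2 * pi))"
    by (simp add: additive_char_def cis_eq_1_iff)
  also have "\<dots> \<longleftrightarrow> (\<exists>n. (of_int k :: real) = of_int (int p * n))"
    using p_gt_1 by (intro ex_cong1) (auto simp: field_simps)
  also have "\<dots> \<longleftrightarrow> int p dvd k"
    unfolding of_int_eq_iff by (auto simp: dvd_def)
  finally show ?thesis .
qed

lemma sum_additive_char:
  "(\<Sum>x\<in>{0..<int p}. additive_char (k * x)) = (if int p dvd k then of_nat p else 0)"
proof -
  have "(\<Sum>x\<in>{0..<int p}. additive_char (k * x)) = (\<Sum>i<p. additive_char (k * int i))"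
    by (rule sum.reindex_bij_witness[of _ int nat]) auto
  also have "\<dots> = (\<Sum>i<p. additive_char k ^ i)"
    by (simp add: additive_char_of_nat_mult)
  also have "\<dots> = (if int p dvd k then of_nat p else 0)"
  proof (cases "int p dvd k")
    case True
    then have "additive_char k = 1" by (simp add: additive_char_eq_1_iff)
    then show ?thesis using True by simp
  next
    case False
    then have "additive_char k \<noteq> 1" by (simp add: additive_char_eq_1_iff)
    moreover have "additive_char k ^ p = 1"
      by (simp flip: additive_char_of_nat_mult add: additive_char_eq_1_iff)
    ultimately show ?thesis using False by (simp add: geometric_sum)
  qed
  finally show ?thesis .
qed

definition mu_hat :: "int \<Rightarrow> complex" where
  "mu_hat k = (\<Sum>a\<in>{0..<int p}. of_real (\<mu> a) * additive_char (- (k * a)))"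

lemma mu_hat_0: "mu_hat 0 = 1"
  using mu_sum by (simp add: mu_hat_def flip: of_real_sum)

lemma norm_mu_hat_le_1: "norm (mu_hat k) \<le> 1"
proof -
  have "norm (mu_hat k) \<le> (\<Sum>a\<in>{0..<int p}. norm (of_real (\<mu> a) * additive_char (- (k * a))))"
    unfolding mu_hat_def by (rule norm_sum)
  then show ?thesis using mu_sum mu_nonneg by (simp add: norm_mult)
qed

text \<open>
  The law charges 0 and, as \<open>\<mu> 0 < 1\<close>, some other residue \<open>b\<close> as well. A character that is nontrivial
  modulo the prime \<open>p\<close> separates \<open>b\<close> from 0, so the contributions of 0 and \<open>b\<close> point in different
  directions and cannot add up to full length.
\<close>

lemma norm_mu_hat_less_1:
  assumes k: "\<not> int p dvd k"
  shows "norm (mu_hat k) < 1"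
proof -
  let ?F = "{0..<int p}"
  have "\<exists>b\<in>?F - {0}. 0 < \<mu> b"
  proof (rule ccontr)
    assume "\<not> ?thesis"
    then have "\<forall>b\<in>?F - {0}. \<mu> b = 0" using mu_nonneg by (metis less_eq_real_def)
    moreover have "(\<Sum>a\<in>?F. \<mu> a) = \<mu> 0 + (\<Sum>a\<in>?F - {0}. \<mu> a)"
      using p_gt_1 by (subst sum.remove[of _ 0]) auto
    ultimately show False using mu_sum mu0_less by simp
  qed
  then obtain b where b: "b \<in> ?F" "b \<noteq> 0" "0 < \<mu> b" by blast
  have split: "(\<Sum>a\<in>?F. g a) = g 0 + g b + (\<Sum>a\<in>?F - {0} - {b}. g a)"
    for g :: "int \<Rightarrow> 'c::comm_monoid_add"
    using p_gt_1 b by (simp add: sum.remove[of ?F 0] sum.remove[of "?F - {0}" b] add.assoc)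
  have "\<not> int p dvd b" using b by (auto dest: zdvd_imp_le)
  then have "\<not> int p dvd k * b"
    using k prime_p by (simp add: prime_dvd_mult_iff)
  then have ne: "additive_char (- (k * b)) \<noteq> 1" by (simp add: additive_char_eq_1_iff)
  have "norm (mu_hat k) \<le> norm (of_real (\<mu> 0) + of_real (\<mu> b) * additive_char (- (k * b)))
      + norm (\<Sum>a\<in>?F - {0} - {b}. of_real (\<mu> a) * additive_char (- (k * a)))"
    unfolding mu_hat_def split by (simp add: norm_triangle_ineq)
  also have "norm (\<Sum>a\<in>?F - {0} - {b}. of_real (\<mu> a) * additive_char (- (k * a)))
      \<le> (\<Sum>a\<in>?F - {0} - {b}. norm (of_real (\<mu> a) * additive_char (- (k * a))))"
    by (rule norm_sum)
  also have "\<dots> = (\<Sum>a\<in>?F - {0} - {b}. \<mu> a)" by (simp add: norm_mult mu_nonneg)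
  also have "norm (of_real (\<mu> 0) + of_real (\<mu> b) * additive_char (- (k * b))) < \<mu> 0 + \<mu> b"
    using mu0_pos b(3) ne by (intro norm_convex_combination_less_sum) auto
  also have "\<mu> 0 + \<mu> b + (\<Sum>a\<in>?F - {0} - {b}. \<mu> a) = 1"
    using mu_sum by (simp add: split[of \<mu>])
  finally show ?thesis by simp
qed

lemma mu_hat_mod: "mu_hat (k mod int p) = mu_hat k"
proof -
  have "additive_char (- (k mod int p * a)) = additive_char (- (k * a))" for a
  proof -
    have "k * a = (int p * (k div int p) + k mod int p) * a" by simp
    also have "\<dots> = int p * (k div int p * a) + k mod int p * a"
      by (simp only: distrib_right mult.assoc)
    finally have "- (k * a) = - (k mod int p * a) + int p * - (k div int p * a)" by simp
    moreover have "additive_char (int p * - (k div int p * a)) = 1"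
      by (simp add: additive_char_eq_1_iff)
    ultimately show ?thesis by (metis additive_char_add mult.right_neutral)
  qed
  then show ?thesis by (simp add: mu_hat_def)
qed

lemma uniform_mu_hat_bound:
  obtains \<rho> where "0 < \<rho>" "\<rho> < 1" "\<And>k. \<not> int p dvd k \<Longrightarrow> norm (mu_hat k) \<le> \<rho>"
proof -
  define S where "S = insert (1/2) ((\<lambda>k. norm (mu_hat k)) ` {1..<int p})"
  have fin: "finite S" and ne: "S \<noteq> {}" by (simp_all add: S_def)
  show ?thesis
  proof
    have "1/2 \<le> Max S" using fin by (intro Max_ge) (auto simp: S_def)
    then show "0 < Max S" by simp
    have "s < 1" if "s \<in> S" for s
      using that by (auto simp: S_def dest: zdvd_imp_le intro!: norm_mu_hat_less_1)
    then show "Max S < 1" using fin ne by simp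
    fix k assume "\<not> int p dvd k"
    then have "k mod int p \<noteq> 0" by (simp add: dvd_eq_mod_eq_0)
    moreover have "0 \<le> k mod int p" "k mod int p < int p" using p_gt_1 by simp_all
    ultimately have "k mod int p \<in> {1..<int p}" by simp
    then have "norm (mu_hat (k mod int p)) \<le> Max S" using fin by (intro Max_ge) (auto simp: S_def)
    then show "norm (mu_hat k) \<le> Max S" by (simp add: mu_hat_mod)
  qed
qed

section \<open>The law of a random linear form\<close>

text \<open>
  The probability that \<open>\<xi>\<^sub>1 v\<^sub>1 + \<dots> + \<xi>\<^sub>n v\<^sub>n\<close> is congruent to \<open>s\<close> modulo \<open>p\<close>, for independent
  \<open>\<xi>\<^sub>j\<close> with law \<open>\<mu>\<close> on residues, computed by conditioning on the last summand. The entries are indexed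
  from 1, as in the vectors of \<open>Fp_vecs\<close>.
\<close>

primrec row_prob :: "nat \<Rightarrow> (nat \<Rightarrow> int) \<Rightarrow> int \<Rightarrow> real" where
  "row_prob 0 v s = (if int p dvd s then 1 else 0)"
| "row_prob (Suc n) v s = (\<Sum>a\<in>{0..<int p}. \<mu> a * row_prob n v (s - a * v (Suc n)))"

lemma row_prob_cong: "(\<And>j. j \<in> {1..n} \<Longrightarrow> v j = w j) \<Longrightarrow> row_prob n v s = row_prob n w s"
  by (induction n arbitrary: s) auto

lemma row_prob_upd [simp]: "i < m \<Longrightarrow> row_prob i (v(m := x)) s = row_prob i v s"
  by (rule row_prob_cong) auto

lemma row_prob_nonneg: "0 \<le> row_prob n v s"
  by (induction n arbitrary: s) (auto intro!: sum_nonneg mult_nonneg_nonneg mu_nonneg)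

lemma row_prob_zero_pos: "0 < row_prob n v 0"
proof (induction n)
  case (Suc n)
  have "0 < \<mu> 0 * row_prob n v (0 - 0 * v (Suc n))" using Suc mu0_pos by simp
  also have "\<dots> \<le> row_prob (Suc n) v 0"
    unfolding row_prob.simps using p_gt_1
    by (intro member_le_sum) (auto intro: mult_nonneg_nonneg mu_nonneg row_prob_nonneg)
  finally show ?case .
qed simp

lemma row_prob_append_0 [simp]: "row_prob (Suc n) (v(Suc n := 0)) s = row_prob n v s"
  using mu_sum by (simp flip: sum_distrib_right)

text \<open>
  Fourier inversion: convolution of laws becomes multiplication of their coefficients.
\<close>

lemma row_prob_fourier:
  "of_real (row_prob n v s) =
     (1 / of_nat p) * (\<Sum>t\<in>{0..<int p}. additive_char (t * s) * (\<Prod>j=1..n. mu_hat (t * v j)))"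
proof (induction n arbitrary: s)
  case 0
  show ?case using p_gt_1 sum_additive_char[of s] by (simp add: mult.commute)
next
  case (Suc n)
  let ?F = "{0..<int p}"
  have "of_real (row_prob (Suc n) v s) = (\<Sum>a\<in>?F. of_real (\<mu> a) * ((1 / of_nat p) *
     (\<Sum>t\<in>?F. additive_char (t * (s - a * v (Suc n))) * (\<Prod>j=1..n. mu_hat (t * v j)))))"
    by (simp add: Suc)
  also have "\<dots> = (1 / of_nat p) * (\<Sum>a\<in>?F. \<Sum>t\<in>?F. of_real (\<mu> a) *
     (additive_char (t * s + - (t * v (Suc n) * a)) * (\<Prod>j=1..n. mu_hat (t * v j))))"
    by (simp add: sum_distrib_left algebra_simps)
  also have "\<dots> = (1 / of_nat p) * (\<Sum>t\<in>?F. \<Sum>a\<in>?F. of_real (\<mu> a) *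
     (additive_char (t * s + - (t * v (Suc n) * a)) * (\<Prod>j=1..n. mu_hat (t * v j))))"
    by (subst sum.swap) simp
  also have "\<dots> = (1 / of_nat p) * (\<Sum>t\<in>?F. additive_char (t * s) * (\<Prod>j=1..Suc n. mu_hat (t * v j)))"
    unfolding additive_char_add
    by (simp add: mu_hat_def sum_distrib_left sum_distrib_right mult_ac)
  finally show ?case .
qed

definition weight :: "nat \<Rightarrow> (nat \<Rightarrow> int) \<Rightarrow> nat" where
  "weight n v = card {j \<in> {1..n}. v j \<noteq> 0}"

lemma weight_append:
  "weight (Suc n) (v(Suc n := x)) = (if x = 0 then weight n v else Suc (weight n v))"
proof -
  have "{j \<in> {1..Suc n}. (v(Suc n := x)) j \<noteq> 0} =
     (if x = 0 then {j \<in> {1..n}. v j \<noteq> 0} else insert (Suc n) {j \<in> {1..n}. v j \<noteq> 0})"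
    by (auto simp: le_Suc_eq)
  then show ?thesis by (simp add: weight_def)
qed

text \<open>
  The term \<open>t = 0\<close> of the inversion formula is the uniform law. In every other term each nonzero entry
  of \<open>v\<close> contributes a factor of modulus at most \<open>\<rho>\<close>, because \<open>p\<close> divides neither \<open>t\<close> nor that entry.
\<close>

lemma row_prob_bound:
  assumes \<rho>: "0 < \<rho>" "\<And>k. \<not> int p dvd k \<Longrightarrow> norm (mu_hat k) \<le> \<rho>" and v: "v \<in> Fp_vecs p n"
  shows "\<bar>real p * row_prob n v s - 1\<bar> \<le> (real p - 1) * \<rho> ^ weight n v"
proof -
  let ?F = "{0..<int p}"
  let ?T = "\<lambda>t. additive_char (t * s) * (\<Prod>j=1..n. mu_hat (t * v j))"
  have "of_real (real p * row_prob n v s) = (\<Sum>t\<in>?F. ?T t)"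
    using p_gt_1 by (simp add: row_prob_fourier)
  also have "\<dots> = 1 + (\<Sum>t\<in>?F - {0}. ?T t)"
    using p_gt_1 by (subst sum.remove[of _ 0]) (auto simp: mu_hat_0)
  finally have eq: "of_real (real p * row_prob n v s - 1) = (\<Sum>t\<in>?F - {0}. ?T t)"
    by simp
  have bd: "norm (?T t) \<le> \<rho> ^ weight n v" if t: "t \<in> ?F - {0}" for t
  proof -
    have "norm (?T t) = (\<Prod>j=1..n. norm (mu_hat (t * v j)))"
      by (simp add: norm_mult prod_norm)
    also have "\<dots> \<le> (\<Prod>j=1..n. if v j \<noteq> 0 then \<rho> else 1)"
    proof (intro prod_mono conjI)
      fix j assume j: "j \<in> {1..n}"
      have "\<not> int p dvd t * v j" if "v j \<noteq> 0"
        using that t Fp_vecs_range[OF v j] prime_p by (auto simp: prime_dvd_mult_iff dest: zdvd_imp_le)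
      then show "norm (mu_hat (t * v j)) \<le> (if v j \<noteq> 0 then \<rho> else 1)"
        using \<rho>(2) norm_mu_hat_le_1 by auto
    qed auto
    also have "\<dots> = \<rho> ^ weight n v"
      unfolding weight_def by (subst prod.If_cases) (auto simp: Int_def)
    finally show ?thesis .
  qed
  have "\<bar>real p * row_prob n v s - 1\<bar> = norm (\<Sum>t\<in>?F - {0}. ?T t)"
    unfolding eq[symmetric] by (rule norm_of_real[symmetric])
  also have "\<dots> \<le> (\<Sum>t\<in>?F - {0}. \<rho> ^ weight n v)"
    by (rule order.trans[OF norm_sum]) (intro sum_mono bd)
  also have "\<dots> = (real p - 1) * \<rho> ^ weight n v"
    using p_gt_1 by (simp add: card_Diff_subset of_nat_diff)
  finally show ?thesis .
qed

text \<open>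
  The averaging identity behind the recursion for the expectation: if the last matrix entry is a nonzero
  residue \<open>a\<close>, then \<open>a * x\<close> runs through all residues and the total is 1; if it is 0, the last
  coordinate does not matter and the total is \<open>p\<close> times the old probability.
\<close>

lemma sum_row_prob_append:
  "(\<Sum>x\<in>{0..<int p}. row_prob (Suc n) (v(Suc n := x)) 0) = 1 + \<mu> 0 * (real p * row_prob n v 0 - 1)"
proof -
  let ?F = "{0..<int p}"
  have uniform: "(\<Sum>x\<in>?F. row_prob n v (- (a * x))) = 1" if a: "a \<in> ?F - {0}" for a
  proof -
    have "of_real (\<Sum>x\<in>?F. row_prob n v (- (a * x))) =
       (\<Sum>x\<in>?F. (1 / of_nat p) * (\<Sum>t\<in>?F. additive_char (t * - (a * x)) * (\<Prod>j=1..n. mu_hat (t * v j))))"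
      by (simp add: row_prob_fourier)
    also have "\<dots> = (1 / of_nat p) * (\<Sum>x\<in>?F. \<Sum>t\<in>?F. additive_char (t * - (a * x)) * (\<Prod>j=1..n. mu_hat (t * v j)))"
      by (simp add: sum_distrib_left)
    also have "\<dots> = (1 / of_nat p) * (\<Sum>t\<in>?F. (\<Sum>x\<in>?F. additive_char ((- (t * a)) * x)) * (\<Prod>j=1..n. mu_hat (t * v j)))"
      by (subst sum.swap) (simp add: sum_distrib_left mult_ac)
    also have "\<dots> = (1 / of_nat p) * (\<Sum>t\<in>?F. if t = 0 then of_nat p else 0)"
    proof (intro arg_cong2[where f="(*)"] sum.cong refl)
      fix t assume t: "t \<in> ?F"
      have "int p dvd t * a \<longleftrightarrow> t = 0"
        using a t prime_p by (auto simp: prime_dvd_mult_iff dest: zdvd_imp_le)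
      then show "(\<Sum>x\<in>?F. additive_char ((- (t * a)) * x)) * (\<Prod>j=1..n. mu_hat (t * v j)) =
          (if t = 0 then of_nat p else 0)"
        unfolding sum_additive_char by (auto simp: mu_hat_0)
    qed
    also have "\<dots> = of_real 1" using p_gt_1 by simp
    finally show ?thesis unfolding of_real_eq_iff .
  qed
  have "(\<Sum>x\<in>?F. row_prob (Suc n) (v(Suc n := x)) 0) =
      (\<Sum>a\<in>?F. \<mu> a * (\<Sum>x\<in>?F. row_prob n v (- (a * x))))"
    by (simp add: sum_distrib_left) (rule sum.swap)
  also have "\<dots> = \<mu> 0 * (real p * row_prob n v 0) + (\<Sum>a\<in>?F - {0}. \<mu> a * 1)"
    using p_gt_1 uniform by (subst sum.remove[of _ 0]) auto
  also have "(\<Sum>a\<in>?F - {0}. \<mu> a * 1) = 1 - \<mu> 0"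
    using mu_sum p_gt_1 by (subst (asm) sum.remove[of _ 0]) auto
  also have "\<mu> 0 * (real p * row_prob n v 0) + (1 - \<mu> 0) = 1 + \<mu> 0 * (real p * row_prob n v 0 - 1)"
    by (simp add: algebra_simps)
  finally show ?thesis .
qed

section \<open>A contracting potential\<close>

text \<open>
  Put \<open>P = row_prob n v 0\<close>. A zero appended to \<open>v\<close> keeps the row sum 0 with probability \<open>P\<close> and leaves the Hamming weight \<open>k\<close>
  unchanged; for the nonzero entries these probabilities add up to \<open>Q\<close>, and this raises \<open>k\<close> to \<open>k + 1\<close>. So one needs
  \<open>P + r Q \<le> \<theta>\<close>, where \<open>r\<close> is the ratio \<open>g (k + 1) / g k\<close>.

  The ratio must not be below \<open>\<rho>\<close> in the long run, since \<open>g\<close> has to dominate \<open>\<rho> ^ k\<close>. For large \<open>k\<close>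
  the ratio \<open>\<rho>\<close> itself works, because there \<open>P\<close> is close to \<open>1/p\<close> and \<open>P + Q\<close> is close to 1. For
  small \<open>k\<close> the sum \<open>P + Q\<close> may well exceed 1, but \<open>P\<close> alone is bounded away from 1 once \<open>k \<ge> 1\<close>, and \<open>Q \<le> p\<close>, so a very
  small ratio works. Using the small ratio for only \<open>K\<close> steps costs just a constant in the comparison with
  \<open>\<rho> ^ k\<close>.
\<close>

lemma contracting_potential:
  obtains g :: "nat \<Rightarrow> real" and \<theta> C :: real
  where "0 \<le> \<theta>" "\<theta> < 1" "0 \<le> C" "\<And>k. 0 < g k" "g \<longlonglongrightarrow> 0"
    "\<And>n v. v \<in> Fp_vecs p n \<Longrightarrow> 1 \<le> weight n v \<Longrightarrow>
       \<bar>real p * row_prob n v 0 - 1\<bar> \<le> C * g (weight n v)"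
    "\<And>n v. v \<in> Fp_vecs p n \<Longrightarrow> 1 \<le> weight n v \<Longrightarrow>
       (\<Sum>x\<in>{0..<int p}. row_prob (Suc n) (v(Suc n := x)) 0 * g (weight (Suc n) (v(Suc n := x))))
         \<le> \<theta> * g (weight n v)"
proof -
  obtain \<rho> where \<rho>: "0 < \<rho>" "\<rho> < 1" and hat: "\<And>k. \<not> int p dvd k \<Longrightarrow> norm (mu_hat k) \<le> \<rho>"
    using uniform_mu_hat_bound by blast
  have p2: "2 \<le> real p" using p_gt_1 by simp
  have "0 < (1 - \<rho>) / (4 * (1 + real p))" using \<rho> by simp
  then obtain K where "\<rho> ^ K < (1 - \<rho>) / (4 * (1 + real p))"
    using real_arch_pow_inv \<rho>(2) by blast
  then have K: "(1 + real p) * \<rho> ^ K \<le> (1 - \<rho>) / 4"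
    by (simp add: field_simps)
  \<comment> \<open>In both regimes the main part of \<open>P + r Q\<close> is at most \<open>(1 + \<rho>) / 2\<close>; the choices of \<open>K\<close> and
    \<open>\<delta>\<close> keep the error below \<open>(1 - \<rho>) / 4\<close>, which gives the common rate \<open>\<theta>\<close>.\<close>
  define \<delta> where "\<delta> = (1 - \<rho>) / (4 * real p)"
  define g where "g k = \<delta> ^ min k K * \<rho> ^ k" for k
  define \<theta> where "\<theta> = (3 + \<rho>) / 4"
  define C where "C = real p / \<delta> ^ K"
  have \<delta>: "0 < \<delta>" "\<delta> \<le> 1" "real p * \<delta> = (1 - \<rho>) / 4"
    using \<rho> p2 by (simp_all add: \<delta>_def field_simps)
  have gpos: "0 < g k" for k using \<delta> \<rho> by (simp add: g_def)
  show ?thesis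
  proof
    show "0 \<le> \<theta>" "\<theta> < 1" using \<rho> by (simp_all add: \<theta>_def)
    show "0 \<le> C" using \<delta> by (simp add: C_def)
    show "0 < g k" for k by (rule gpos)
    have gle: "g k \<le> \<rho> ^ k" for k
      unfolding g_def using \<delta> \<rho> by (intro mult_left_le_one_le) (auto simp: power_le_one)
    show "g \<longlonglongrightarrow> 0"
    proof (rule real_tendsto_sandwich[of "\<lambda>_. 0" _ _ "\<lambda>k. \<rho> ^ k"])
      show "(\<lambda>k. \<rho> ^ k) \<longlonglongrightarrow> 0" using \<rho> by (intro LIMSEQ_realpow_zero) auto
    qed (simp_all add: gle gpos less_imp_le)
  next
    fix n v assume v: "v \<in> Fp_vecs p n" and k1: "1 \<le> weight n v"
    let ?k = "weight n v" and ?P = "row_prob n v 0"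
    have b: "\<bar>real p * ?P - 1\<bar> \<le> (real p - 1) * \<rho> ^ ?k"
      by (rule row_prob_bound[OF \<rho>(1) hat v])
    have "\<delta> ^ K * \<rho> ^ ?k \<le> g ?k"
      unfolding g_def using \<delta> \<rho> by (intro mult_right_mono power_decreasing) auto
    then have rg: "\<rho> ^ ?k \<le> g ?k / \<delta> ^ K" using \<delta> by (simp add: field_simps)
    note b
    also have "(real p - 1) * \<rho> ^ ?k \<le> real p * (g ?k / \<delta> ^ K)"
      using rg \<rho> p2 by (intro mult_mono) auto
    finally show "\<bar>real p * ?P - 1\<bar> \<le> C * g ?k" by (simp add: C_def)
    define Q where "Q = (\<Sum>x\<in>{0..<int p} - {0}. row_prob (Suc n) (v(Suc n := x)) 0)"
    have P0: "row_prob (Suc n) (v(Suc n := 0)) 0 = ?P"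
      by (rule row_prob_append_0)
    have "?P + Q = (\<Sum>x\<in>{0..<int p}. row_prob (Suc n) (v(Suc n := x)) 0)"
      unfolding Q_def using p_gt_1 P0
      by (subst sum.remove[of "{0..<int p}" 0]) (auto simp del: row_prob.simps row_prob_append_0)
    then have PQ: "?P + Q = 1 + \<mu> 0 * (real p * ?P - 1)"
      by (simp only: sum_row_prob_append)
    have Q0: "0 \<le> Q" unfolding Q_def by (intro sum_nonneg row_prob_nonneg)
    have P0': "0 \<le> ?P" by (rule row_prob_nonneg)
    have step: "(\<Sum>x\<in>{0..<int p}. row_prob (Suc n) (v(Suc n := x)) 0 * g (weight (Suc n) (v(Suc n := x))))
       = ?P * g ?k + Q * g (Suc ?k)"
    proof -
      have "(\<Sum>x\<in>{0..<int p} - {0}. row_prob (Suc n) (v(Suc n := x)) 0 * g (weight (Suc n) (v(Suc n := x))))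
         = Q * g (Suc ?k)"
        unfolding Q_def sum_distrib_right
        by (intro sum.cong refl) (simp add: weight_append del: row_prob.simps)
      then show ?thesis using p_gt_1 P0
        by (subst sum.remove[of "{0..<int p}" 0])
          (auto simp: weight_append simp del: row_prob.simps row_prob_append_0)
    qed
    have dev: "\<mu> 0 * (real p * ?P - 1) \<le> \<bar>real p * ?P - 1\<bar>"
    proof -
      have "\<mu> 0 * (real p * ?P - 1) \<le> \<mu> 0 * \<bar>real p * ?P - 1\<bar>"
        using mu0_pos by (intro mult_left_mono) auto
      also have "\<dots> \<le> \<bar>real p * ?P - 1\<bar>"
        using mu0_pos mu0_less by (intro mult_left_le_one_le) auto
      finally show ?thesis .
    qed
    have "?P + Q * (if ?k < K then \<delta> * \<rho> else \<rho>) \<le> \<theta>"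
    proof (cases "?k < K")
      case True
      have rk: "\<rho> ^ ?k \<le> \<rho>" using power_decreasing[of 1 ?k \<rho>] k1 \<rho> by simp
      have b1: "\<bar>real p * ?P - 1\<bar> \<le> (real p - 1) * \<rho>"
        using b mult_left_mono[OF rk, of "real p - 1"] p2 by linarith
      have "real p * ?P \<le> 1 + (real p - 1) * \<rho>" using b1 by linarith
      also have "\<dots> \<le> real p * ((1 + \<rho>) / 2)"
      proof -
        have "0 \<le> (real p - 2) * (1 - \<rho>)" using p2 \<rho> by (intro mult_nonneg_nonneg) auto
        then show ?thesis by (simp add: algebra_simps)
      qed
      finally have P: "?P \<le> (1 + \<rho>) / 2" using p2 by simp
      have "(real p - 1) * \<rho> \<le> real p - 1" using p2 \<rho> by (intro mult_left_le) auto
      then have Q: "Q \<le> real p" using PQ dev b1 P0' by linarith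
      have "Q * (\<delta> * \<rho>) \<le> real p * (\<delta> * 1)"
        using Q Q0 \<delta> \<rho> by (intro mult_mono) auto
      then show ?thesis using True P \<delta>(3) by (simp add: \<theta>_def field_simps)
    next
      case False
      have "\<rho> ^ ?k \<le> \<rho> ^ K" using False \<rho> by (intro power_decreasing) auto
      then have "(real p - 1) * \<rho> ^ ?k \<le> real p * \<rho> ^ K"
        using p2 \<rho> by (intro mult_mono) auto
      then have b2: "\<bar>real p * ?P - 1\<bar> \<le> real p * \<rho> ^ K" using b by linarith
      have "real p * ?P \<le> real p * (1 / 2 + \<rho> ^ K)"
        using b2 p2 by (simp add: algebra_simps)
      then have P: "?P \<le> 1 / 2 + \<rho> ^ K" using p2 by simp
      have s: "?P + Q \<le> 1 + real p * \<rho> ^ K" using PQ dev b2 by linarith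
      have "?P + Q * \<rho> = (1 - \<rho>) * ?P + \<rho> * (?P + Q)" by (simp add: algebra_simps)
      also have "\<dots> \<le> (1 - \<rho>) * (1 / 2 + \<rho> ^ K) + \<rho> * (1 + real p * \<rho> ^ K)"
        using \<rho> by (intro add_mono mult_left_mono[OF P] mult_left_mono[OF s]) auto
      also have "\<dots> = (1 + \<rho>) / 2 + ((1 - \<rho>) * \<rho> ^ K + \<rho> * (real p * \<rho> ^ K))"
        by (simp add: ring_distribs diff_divide_distrib add_divide_distrib)
      also have "(1 - \<rho>) * \<rho> ^ K + \<rho> * (real p * \<rho> ^ K) \<le> \<rho> ^ K + real p * \<rho> ^ K"
        using \<rho> by (intro add_mono mult_left_le_one_le) auto
      also have "\<dots> \<le> (1 - \<rho>) / 4" using K by (simp add: algebra_simps)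
      finally show ?thesis using False by (simp add: \<theta>_def field_simps)
    qed
    then have "(?P + Q * (if ?k < K then \<delta> * \<rho> else \<rho>)) * g ?k \<le> \<theta> * g ?k"
      using gpos[of ?k] by (intro mult_right_mono) auto
    moreover have "g (Suc ?k) = (if ?k < K then \<delta> * \<rho> else \<rho>) * g ?k"
      by (auto simp: g_def min_def not_less Suc_le_eq)
    ultimately show "(\<Sum>x\<in>{0..<int p}. row_prob (Suc n) (v(Suc n := x)) 0 *
         g (weight (Suc n) (v(Suc n := x)))) \<le> \<theta> * g ?k"
      unfolding step by (simp only: ring_distribs mult.assoc)
  qed
qed

section \<open>Convergence and positivity\<close>

text \<open>
  The probability that a random lower triangular matrix annihilates \<open>v\<close>: the product over its independent
  rows.
\<close>

definition vec_prob :: "nat \<Rightarrow> (nat \<Rightarrow> int) \<Rightarrow> real" where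
  "vec_prob n v = (\<Prod>i=1..n. row_prob i v 0)"

lemma vec_prob_pos: "0 < vec_prob n v"
  unfolding vec_prob_def by (intro prod_pos ballI row_prob_zero_pos)

lemma vec_prob_append:
  "vec_prob (Suc n) (v(Suc n := x)) = vec_prob n v * row_prob (Suc n) (v(Suc n := x)) 0"
  by (simp add: vec_prob_def del: row_prob.simps)

lemma weighted_sum_step:
  assumes "\<And>v x. v \<in> Fp_vecs p n \<Longrightarrow> x \<in> {0..<int p} \<Longrightarrow> Q (v(Suc n := x)) \<longleftrightarrow> Q v"
  shows "(\<Sum>v | v \<in> Fp_vecs p (Suc n) \<and> Q v. vec_prob (Suc n) v * f v)
       = (\<Sum>v | v \<in> Fp_vecs p n \<and> Q v. vec_prob n v *
            (\<Sum>x\<in>{0..<int p}. row_prob (Suc n) (v(Suc n := x)) 0 * f (v(Suc n := x))))"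
  using assms
  by (subst sum_Fp_vecs_Suc) (simp_all add: vec_prob_append sum_distrib_left mult.assoc del: row_prob.simps)

text \<open>
  Convergence compares the increments with the potential, which decays geometrically. For positivity,
  subtract a multiple of the potential so that the loss in one step is always compensated by the
  contraction, and start from a vector so heavy that the subtracted term is less than 1.
\<close>

theorem sum_vec_prob_converges:
  "\<exists>\<chi>\<^sub>0>0. (\<lambda>n. \<Sum>v | v \<in> Fp_vecs p n \<and> v 1 \<noteq> 0. vec_prob n v) \<longlonglongrightarrow> \<chi>\<^sub>0"
proof -
  obtain g \<theta> C where \<theta>: "0 \<le> \<theta>" "\<theta> < 1" and C: "0 \<le> C" and gpos: "\<And>k. 0 < g k"
    and glim: "g \<longlonglongrightarrow> 0"
    and dev: "\<And>n v. v \<in> Fp_vecs p n \<Longrightarrow> 1 \<le> weight n v \<Longrightarrow>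
       \<bar>real p * row_prob n v 0 - 1\<bar> \<le> C * g (weight n v)"
    and contr: "\<And>n v. v \<in> Fp_vecs p n \<Longrightarrow> 1 \<le> weight n v \<Longrightarrow>
       (\<Sum>x\<in>{0..<int p}. row_prob (Suc n) (v(Suc n := x)) 0 * g (weight (Suc n) (v(Suc n := x))))
         \<le> \<theta> * g (weight n v)"
    by (rule contracting_potential) (rule that, assumption+)
  define X where "X n = {v. v \<in> Fp_vecs p n \<and> v 1 \<noteq> 0}" for n
  define E where "E n = (\<Sum>v\<in>X n. vec_prob n v)" for n
  define G where "G n = (\<Sum>v\<in>X n. vec_prob n v * g (weight n v))" for n
  have finX: "finite (X n)" for n
    unfolding X_def by (rule finite_subset[OF _ finite_Fp_vecs[of p n]]) auto
  have wt: "1 \<le> weight n v" if "v \<in> X n" "1 \<le> n" for n v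
  proof -
    have "card {1::nat} \<le> weight n v"
      unfolding weight_def using that by (intro card_mono) (auto simp: X_def)
    then show ?thesis by simp
  qed
  have dev0: "\<bar>\<mu> 0 * (real p * row_prob n v 0 - 1)\<bar> \<le> C * g (weight n v)"
    if "v \<in> Fp_vecs p n" "1 \<le> weight n v" for n v
  proof -
    have "\<bar>\<mu> 0 * (real p * row_prob n v 0 - 1)\<bar> \<le> \<bar>real p * row_prob n v 0 - 1\<bar>"
      unfolding abs_mult using mu0_pos mu0_less by (intro mult_left_le_one_le) auto
    then show ?thesis using dev[OF that] by linarith
  qed
  have Estep: "E (Suc n) = E n + (\<Sum>v\<in>X n. vec_prob n v * (\<mu> 0 * (real p * row_prob n v 0 - 1)))"
    if n: "1 \<le> n" for n
  proof -
    have "E (Suc n) = (\<Sum>v | v \<in> Fp_vecs p (Suc n) \<and> v 1 \<noteq> 0. vec_prob (Suc n) v * 1)"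
      by (simp add: E_def X_def)
    also have "\<dots> = (\<Sum>v\<in>X n. vec_prob n v * (1 + \<mu> 0 * (real p * row_prob n v 0 - 1)))"
      using n by (subst weighted_sum_step)
        (simp_all add: X_def sum_row_prob_append del: row_prob.simps)
    finally show ?thesis by (simp add: E_def ring_distribs sum.distrib)
  qed
  have Gstep: "G (Suc n) \<le> \<theta> * G n" if n: "1 \<le> n" for n
  proof -
    have "G (Suc n) = (\<Sum>v\<in>X n. vec_prob n v * (\<Sum>x\<in>{0..<int p}.
        row_prob (Suc n) (v(Suc n := x)) 0 * g (weight (Suc n) (v(Suc n := x)))))"
      unfolding G_def X_def using n by (subst weighted_sum_step) auto
    also have "\<dots> \<le> (\<Sum>v\<in>X n. vec_prob n v * (\<theta> * g (weight n v)))"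
      using contr wt[OF _ n] less_imp_le[OF vec_prob_pos]
      by (intro sum_mono mult_left_mono) (auto simp: X_def)
    finally show ?thesis by (simp add: G_def sum_distrib_left mult_ac)
  qed
  have Gbound: "G (Suc n) \<le> \<theta> ^ n * G 1" for n
  proof (induction n)
    case (Suc n)
    have "G (Suc (Suc n)) \<le> \<theta> * G (Suc n)" by (rule Gstep) simp
    also have "\<dots> \<le> \<theta> * (\<theta> ^ n * G 1)" using Suc \<theta> by (intro mult_left_mono)
    finally show ?case by (simp add: mult.assoc)
  qed simp
  have Ediff: "\<bar>E (Suc (Suc n)) - E (Suc n)\<bar> \<le> C * G 1 * \<theta> ^ n" for n
  proof -
    let ?n = "Suc n"
    have "\<bar>E (Suc ?n) - E ?n\<bar> = \<bar>\<Sum>v\<in>X ?n. vec_prob ?n v * (\<mu> 0 * (real p * row_prob ?n v 0 - 1))\<bar>"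
      using Estep[of ?n] by simp
    also have "\<dots> \<le> (\<Sum>v\<in>X ?n. \<bar>vec_prob ?n v * (\<mu> 0 * (real p * row_prob ?n v 0 - 1))\<bar>)"
      by (rule sum_abs)
    also have "\<dots> \<le> (\<Sum>v\<in>X ?n. vec_prob ?n v * (C * g (weight ?n v)))"
    proof (rule sum_mono)
      fix v assume v: "v \<in> X ?n"
      then have "\<bar>\<mu> 0 * (real p * row_prob ?n v 0 - 1)\<bar> \<le> C * g (weight ?n v)"
        by (intro dev0 wt) (auto simp: X_def)
      then have "vec_prob ?n v * \<bar>\<mu> 0 * (real p * row_prob ?n v 0 - 1)\<bar>
          \<le> vec_prob ?n v * (C * g (weight ?n v))"
        using vec_prob_pos[of ?n v] by (intro mult_left_mono) auto
      then show "\<bar>vec_prob ?n v * (\<mu> 0 * (real p * row_prob ?n v 0 - 1))\<bar>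
          \<le> vec_prob ?n v * (C * g (weight ?n v))"
        using vec_prob_pos[of ?n v] by (simp only: abs_mult[of "vec_prob ?n v"] abs_of_pos)
    qed
    also have "\<dots> = C * G ?n" by (simp add: G_def sum_distrib_left mult_ac)
    also have "\<dots> \<le> C * (\<theta> ^ n * G 1)" using Gbound C by (intro mult_left_mono)
    finally show ?thesis by (simp add: mult_ac)
  qed
  have "summable (\<lambda>n. C * G 1 * \<theta> ^ n)"
    using \<theta> by (intro summable_mult summable_geometric) auto
  then have "summable (\<lambda>n. E (Suc (Suc n)) - E (Suc n))"
    by (rule summable_comparison_test'[where N = 0]) (simp only: real_norm_def Ediff)
  then have "(\<lambda>n. \<Sum>i<n. E (Suc (Suc i)) - E (Suc i)) \<longlonglongrightarrow> (\<Sum>i. E (Suc (Suc i)) - E (Suc i))"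
    by (rule summable_LIMSEQ)
  then have "(\<lambda>n. (E (Suc n) - E (Suc 0)) + E (Suc 0)) \<longlonglongrightarrow> (\<Sum>i. E (Suc (Suc i)) - E (Suc i)) + E (Suc 0)"
    unfolding sum_lessThan_telescope[of "\<lambda>n. E (Suc n)"] by (intro tendsto_add tendsto_const)
  then have "(\<lambda>n. E (Suc n)) \<longlonglongrightarrow> (\<Sum>i. E (Suc (Suc i)) - E (Suc i)) + E (Suc 0)" by simp
  then obtain \<chi>\<^sub>0 where \<chi>\<^sub>0: "E \<longlonglongrightarrow> \<chi>\<^sub>0" by (metis filterlim_sequentially_Suc)

  \<comment> \<open>One step loses at most \<open>C * g\<close> of the mass and gains at least \<open>D * (1 - \<theta>) * g\<close> from the contraction;
    this \<open>D\<close> balances the two.\<close>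
  define D where "D = C / (1 - \<theta>)"
  have D: "0 \<le> D" "C + \<theta> * D = D" using \<theta> C by (simp_all add: D_def field_simps)
  have "(\<lambda>k. D * g k) \<longlonglongrightarrow> D * 0" by (intro tendsto_mult tendsto_const glim)
  then have "eventually (\<lambda>k. D * g k < 1) sequentially" by (rule order_tendstoD) simp
  then have "eventually (\<lambda>k. D * g k < 1 \<and> 1 \<le> k) sequentially"
    using eventually_ge_at_top by (rule eventually_conj)
  then obtain m where "\<forall>k\<ge>m. D * g k < 1 \<and> 1 \<le> k"
    unfolding eventually_sequentially by blast
  then have m: "D * g m < 1" "1 \<le> m" by simp_all
  \<comment> \<open>The vectors starting with \<open>m\<close> ones; they have weight at least \<open>m\<close>.\<close>
  define Y where "Y n = {v. v \<in> Fp_vecs p n \<and> (\<forall>j\<in>{1..m}. v j = 1)}" for n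
  define H where "H n = (\<Sum>v\<in>Y n. vec_prob n v * (1 - D * g (weight n v)))" for n
  have YX: "Y n \<subseteq> X n" for n using m by (auto simp: Y_def X_def)
  have Hstep: "H n \<le> H (Suc n)" if n: "m \<le> n" for n
  proof -
    have "H n \<le> (\<Sum>v\<in>Y n. vec_prob n v * (\<Sum>x\<in>{0..<int p}. row_prob (Suc n) (v(Suc n := x)) 0 *
        (1 - D * g (weight (Suc n) (v(Suc n := x))))))"
      unfolding H_def
    proof (intro sum_mono mult_left_mono less_imp_le[OF vec_prob_pos])
      fix v assume "v \<in> Y n"
      then have "v \<in> X n" using YX by blast
      then have v: "v \<in> Fp_vecs p n" and w: "1 \<le> weight n v"
        using wt[of v n] m n by (auto simp: X_def)
      let ?S = "\<Sum>x\<in>{0..<int p}. row_prob (Suc n) (v(Suc n := x)) 0 * g (weight (Suc n) (v(Suc n := x)))"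
      have "(C + \<theta> * D) * g (weight n v) = D * g (weight n v)" by (simp only: D(2))
      then have "1 - D * g (weight n v) = 1 - C * g (weight n v) - D * (\<theta> * g (weight n v))"
        by (simp add: algebra_simps)
      also have "\<dots> \<le> 1 + \<mu> 0 * (real p * row_prob n v 0 - 1) - D * ?S"
      proof -
        have "D * ?S \<le> D * (\<theta> * g (weight n v))" using contr[OF v w] D(1) by (rule mult_left_mono)
        then show ?thesis using dev0[OF v w] by linarith
      qed
      also have "\<dots> = (\<Sum>x\<in>{0..<int p}. row_prob (Suc n) (v(Suc n := x)) 0 *
          (1 - D * g (weight (Suc n) (v(Suc n := x)))))"
        unfolding sum_row_prob_append[symmetric]
        by (simp add: right_diff_distrib sum_subtractf sum_distrib_left mult_ac del: row_prob.simps)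
      finally show "1 - D * g (weight n v) \<le> (\<Sum>x\<in>{0..<int p}. row_prob (Suc n) (v(Suc n := x)) 0 *
          (1 - D * g (weight (Suc n) (v(Suc n := x)))))" .
    qed
    also have "\<dots> = H (Suc n)"
      unfolding H_def Y_def using n by (subst weighted_sum_step) auto
    finally show ?thesis .
  qed
  have Hm: "0 < H m"
    unfolding H_def
  proof (intro sum_pos mult_pos_pos vec_prob_pos)
    show "finite (Y m)" using finX YX finite_subset by blast
    have "(\<lambda>j\<in>{1..m}. 1) \<in> Y m"
      using p_gt_1 by (auto simp: Y_def Fp_vecs_def residue_ring_def)
    then show "Y m \<noteq> {}" by blast
    fix v assume "v \<in> Y m"
    then have "{j \<in> {1..m}. v j \<noteq> 0} = {1..m}" by (auto simp: Y_def)
    then have "weight m v = m" by (simp add: weight_def)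
    then show "0 < 1 - D * g (weight m v)" using m by simp
  qed
  have "H m \<le> E n" if n: "m \<le> n" for n
  proof -
    have "H m \<le> H n" using n by (induction n rule: dec_induct) (auto intro: order.trans Hstep)
    also have "\<dots> \<le> (\<Sum>v\<in>Y n. vec_prob n v)"
      unfolding H_def using D(1) less_imp_le[OF gpos] less_imp_le[OF vec_prob_pos]
      by (intro sum_mono mult_left_le) auto
    also have "\<dots> \<le> E n"
      unfolding E_def using YX finX less_imp_le[OF vec_prob_pos] by (intro sum_mono2) auto
    finally show ?thesis .
  qed
  then have "H m \<le> \<chi>\<^sub>0" by (intro LIMSEQ_le_const[OF \<chi>\<^sub>0]) auto
  then have "0 < \<chi>\<^sub>0" using Hm by linarith
  then show ?thesis using \<chi>\<^sub>0 unfolding E_def X_def by blast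
qed

end

section \<open>The expected number of kernel vectors\<close>

lemma Fp_mat_vec_eq_zero_iff:
  assumes p: "1 < p"
    and tri: "\<And>i j. 1 \<le> i \<Longrightarrow> i < j \<Longrightarrow> j \<le> n \<Longrightarrow> A i j = 0"
  shows "Fp_mat_vec p n A v = Fp_zero_vec p n \<longleftrightarrow>
    (\<forall>i\<in>{1..n}. int p dvd (\<Sum>j=1..i. A i j * v j))"
proof -
  interpret residues "int p" "residue_ring (int p)"
    using p by unfold_locales auto
  have row: "finsum (residue_ring (int p))
      (\<lambda>j. (A i j mod int p) \<otimes>\<^bsub>residue_ring (int p)\<^esub> v j) {1..n} = (\<Sum>j=1..i. A i j * v j) mod int p"
    if i: "i \<in> {1..n}" for i
  proof -
    have "(A i j mod int p) \<otimes>\<^bsub>residue_ring (int p)\<^esub> v j = (A i j * v j) mod int p" for j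
      by (simp add: res_mult_eq mod_mult_left_eq)
    then have "finsum (residue_ring (int p))
      (\<lambda>j. (A i j mod int p) \<otimes>\<^bsub>residue_ring (int p)\<^esub> v j) {1..n} = (\<Sum>j=1..n. A i j * v j) mod int p"
      by (simp add: sum_cong)
    also have "(\<Sum>j=1..n. A i j * v j) = (\<Sum>j=1..i. A i j * v j)"
      using i tri by (intro sum.mono_neutral_right) auto
    finally show ?thesis .
  qed
  have "Fp_mat_vec p n A v = Fp_zero_vec p n \<longleftrightarrow>
      (\<forall>i\<in>{1..n}. finsum (residue_ring (int p))
        (\<lambda>j. (A i j mod int p) \<otimes>\<^bsub>residue_ring (int p)\<^esub> v j) {1..n} = 0)"
    unfolding Fp_mat_vec_def Fp_zero_vec_def res_zero_eq by (auto simp: fun_eq_iff)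
  also have "\<dots> \<longleftrightarrow> (\<forall>i\<in>{1..n}. (\<Sum>j=1..i. A i j * v j) mod int p = 0)"
    by (intro ball_cong refl) (simp only: row)
  finally show ?thesis by (simp only: dvd_eq_mod_eq_0)
qed

lemma PiM_count_space_UNIV_int:
  "finite A \<Longrightarrow> PiM A (\<lambda>_. count_space (UNIV :: int set)) = count_space (PiE A (\<lambda>_. UNIV))"
  by (intro count_space_PiM_finite) auto

text \<open>
  Condition on the residue of the last summand, which is independent of the others. The map \<open>\<iota>\<close> selects
  the row from a larger independent family, such as the entries of a matrix.
\<close>

lemma (in residue_distribution) prob_row_sum_eq_row_prob:
  fixes X :: "'i \<Rightarrow> 'b \<Rightarrow> int" and \<iota> :: "nat \<Rightarrow> 'i"
  assumes N: "prob_space N"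
    and ind: "prob_space.indep_vars N (\<lambda>_. count_space UNIV) X I"
    and law: "\<And>i a. i \<in> I \<Longrightarrow> measure N {\<omega> \<in> space N. X i \<omega> mod int p = a} = \<mu> a"
    and inj: "inj_on \<iota> {1..k}" and I: "\<iota> ` {1..k} \<subseteq> I"
  shows "measure N {\<omega> \<in> space N. int p dvd s - (\<Sum>j=1..k. X (\<iota> j) \<omega> * v j)} = row_prob k v s"
  using inj I
proof (induction k arbitrary: s)
  case 0
  interpret prob_space N by (rule N)
  show ?case by (simp add: prob_space)
next
  case (Suc k)
  interpret prob_space N by (rule N)
  have IH: "measure N {\<omega> \<in> space N. int p dvd t - (\<Sum>j=1..k. X (\<iota> j) \<omega> * v j)} = row_prob k v t" for t
    using Suc.prems by (intro Suc.IH) (auto simp: inj_on_def)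
  let ?new = "\<iota> (Suc k)" and ?old = "\<iota> ` {1..k}"
  let ?S = "\<lambda>t \<omega>. t - (\<Sum>j=1..k. X (\<iota> j) \<omega> * v j)"
  let ?A = "\<lambda>a. {\<omega> \<in> space N. X ?new \<omega> mod int p = a \<and> int p dvd ?S (s - a * v (Suc k)) \<omega>}"
  have disj: "{?new} \<inter> ?old = {}"
  proof -
    have "\<iota> (Suc k) \<noteq> \<iota> j" if "j \<in> {1..k}" for j
      using inj_onD[OF Suc.prems(1), of "Suc k" j] that by auto
    then show ?thesis by blast
  qed
  have new: "?new \<in> I" and old: "?old \<subseteq> I" using Suc.prems(2) by auto
  have iv: "indep_var (PiM {?new} (\<lambda>_. count_space UNIV)) (\<lambda>\<omega>. \<lambda>i\<in>{?new}. X i \<omega>)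
      (PiM ?old (\<lambda>_. count_space UNIV)) (\<lambda>\<omega>. \<lambda>i\<in>?old. X i \<omega>)"
    using new old disj by (intro indep_var_restrict[OF ind]) auto
  have A: "prob (?A a) = \<mu> a * row_prob k v (s - a * v (Suc k))" for a
  proof -
    let ?R = "{r \<in> PiE {?new} (\<lambda>_. UNIV). r ?new mod int p = a}"
    let ?T = "{r \<in> PiE ?old (\<lambda>_. UNIV). int p dvd (s - a * v (Suc k)) - (\<Sum>j=1..k. r (\<iota> j) * v j)}"
    have "prob ((\<lambda>\<omega>. (\<lambda>i\<in>{?new}. X i \<omega>, \<lambda>i\<in>?old. X i \<omega>)) -` (?R \<times> ?T) \<inter> space N) =
        prob ((\<lambda>\<omega>. \<lambda>i\<in>{?new}. X i \<omega>) -` ?R \<inter> space N) * prob ((\<lambda>\<omega>. \<lambda>i\<in>?old. X i \<omega>) -` ?T \<inter> space N)"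
      by (intro indep_varD[OF iv]) (auto simp: PiM_count_space_UNIV_int)
    also have "(\<lambda>\<omega>. (\<lambda>i\<in>{?new}. X i \<omega>, \<lambda>i\<in>?old. X i \<omega>)) -` (?R \<times> ?T) \<inter> space N = ?A a"
      by auto
    also have "(\<lambda>\<omega>. \<lambda>i\<in>{?new}. X i \<omega>) -` ?R \<inter> space N = {\<omega> \<in> space N. X ?new \<omega> mod int p = a}"
      by auto
    also have "(\<lambda>\<omega>. \<lambda>i\<in>?old. X i \<omega>) -` ?T \<inter> space N =
        {\<omega> \<in> space N. int p dvd ?S (s - a * v (Suc k)) \<omega>}"
      by auto
    finally show ?thesis by (simp only: IH law[OF new])
  qed
  have meas: "X i \<in> measurable N (count_space UNIV)" if "i \<in> I" for i
    using ind that by (auto simp: indep_vars_def)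
  have "?A a \<in> events" for a
  proof -
    have m_new: "X ?new \<in> measurable N (count_space UNIV)" by (rule meas[OF new])
    have m_old: "(\<lambda>\<omega>. \<lambda>i\<in>?old. X i \<omega>) \<in> measurable N (count_space (PiE ?old (\<lambda>_. UNIV)))"
      using old by (subst PiM_count_space_UNIV_int[symmetric]) (auto intro!: measurable_restrict meas)
    have "?A a = {\<omega> \<in> space N. X ?new \<omega> mod int p = a \<and>
        int p dvd (s - a * v (Suc k)) - (\<Sum>j=1..k. (\<lambda>i\<in>?old. X i \<omega>) (\<iota> j) * v j)}"
      by auto
    also have "\<dots> = (X ?new -` {x. x mod int p = a} \<inter> space N) \<inter> ((\<lambda>\<omega>. \<lambda>i\<in>?old. X i \<omega>) -`
        {r \<in> PiE ?old (\<lambda>_. UNIV). int p dvd (s - a * v (Suc k)) - (\<Sum>j=1..k. r (\<iota> j) * v j)} \<inter> space N)"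
      by auto
    also have "\<dots> \<in> events" by (intro sets.Int measurable_sets[OF m_new] measurable_sets[OF m_old]) auto
    finally show ?thesis .
  qed
  moreover have "{\<omega> \<in> space N. int p dvd ?S s \<omega> - X ?new \<omega> * v (Suc k)} = (\<Union>a\<in>{0..<int p}. ?A a)"
  proof -
    have "int p dvd ?S s \<omega> - X ?new \<omega> * v (Suc k) \<longleftrightarrow>
        int p dvd ?S (s - (X ?new \<omega> mod int p) * v (Suc k)) \<omega>" for \<omega>
    proof -
      have "?S (s - (X ?new \<omega> mod int p) * v (Suc k)) \<omega>
          = (?S s \<omega> - X ?new \<omega> * v (Suc k)) + int p * (X ?new \<omega> div int p * v (Suc k))"
      proof -
        have "X ?new \<omega> * v (Suc k) = (int p * (X ?new \<omega> div int p) + X ?new \<omega> mod int p) * v (Suc k)"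
          by simp
        also have "\<dots> = int p * (X ?new \<omega> div int p * v (Suc k)) + X ?new \<omega> mod int p * v (Suc k)"
          by (simp only: distrib_right mult.assoc)
        finally show ?thesis by linarith
      qed
      then show ?thesis by (simp only: dvd_add_left_iff[OF dvd_triv_left])
    qed
    then show ?thesis using p_gt_1 by auto
  qed
  moreover have "disjoint_family_on ?A {0..<int p}" by (auto simp: disjoint_family_on_def)
  ultimately
  have "prob {\<omega> \<in> space N. int p dvd ?S s \<omega> - X ?new \<omega> * v (Suc k)}
      = (\<Sum>a\<in>{0..<int p}. prob (?A a))"
    by (simp only:) (intro finite_measure_finite_Union, auto)
  also have "\<dots> = row_prob (Suc k) v s"
    by (simp only: A row_prob.simps)
  finally show ?case by (simp add: diff_diff_eq del: row_prob.simps)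
qed

text \<open>
  By linearity of expectation it is enough to know the probability that a single vector is annihilated,
  and that factorizes over the rows, which are disjoint blocks of an independent family.
\<close>

lemma (in residue_distribution) expected_kernel_card:
  assumes N: "prob_space N" and iid: "iid_lower_triangular N D n L" and n: "1 \<le> n"
    and D: "\<And>a. measure D {x. x mod int p = a} = \<mu> a"
  shows "(\<integral>\<omega>. real (card {v \<in> Fp_vecs p n. v 1 \<noteq> \<zero>\<^bsub>residue_ring (int p)\<^esub> \<and>
             Fp_mat_vec p n (L \<omega>) v = Fp_zero_vec p n}) \<partial>N)
    = (\<Sum>v | v \<in> Fp_vecs p n \<and> v 1 \<noteq> 0. vec_prob n v)"
proof -
  interpret prob_space N by (rule N)
  define I where "I = {(i, j). 1 \<le> j \<and> j \<le> i \<and> i \<le> n}"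
  define X where "X = (\<lambda>(i, j) \<omega>. L \<omega> i j)"
  have ind: "indep_vars (\<lambda>_. count_space UNIV) X I"
    using iid by (simp add: iid_lower_triangular_def I_def X_def)
  have tri: "L \<omega> i j = 0" if "\<omega> \<in> space N" "1 \<le> i" "i < j" "j \<le> n" for \<omega> i j
    using iid that by (simp add: iid_lower_triangular_def)
  have meas: "X i \<in> measurable N (count_space UNIV)" if "i \<in> I" for i
    using ind that by (auto simp: indep_vars_def)
  have law: "measure N {\<omega> \<in> space N. X i \<omega> mod int p = a} = \<mu> a" if i: "i \<in> I" for i a
  proof -
    have "distr N (count_space UNIV) (X i) = D"
      using iid i by (auto simp: iid_lower_triangular_def I_def X_def)
    then have "\<mu> a = measure (distr N (count_space UNIV) (X i)) {x. x mod int p = a}"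
      using D by simp
    also have "\<dots> = measure N (X i -` {x. x mod int p = a} \<inter> space N)"
      using meas[OF i] by (intro measure_distr) auto
    also have "X i -` {x. x mod int p = a} \<inter> space N = {\<omega> \<in> space N. X i \<omega> mod int p = a}"
      by auto
    finally show ?thesis by simp
  qed
  define row where "row i = {i} \<times> {1..i}" for i :: nat
  define kernel where "kernel v = (\<Inter>i\<in>{1..n}.
      (\<lambda>\<omega>. \<lambda>k\<in>row i. X k \<omega>) -` {r \<in> PiE (row i) (\<lambda>_. UNIV). int p dvd (\<Sum>j=1..i. r (i, j) * v j)} \<inter> space N)"
    for v
  have rows: "indep_vars (\<lambda>i. PiM (row i) (\<lambda>_. count_space UNIV)) (\<lambda>i \<omega>. \<lambda>k\<in>row i. X k \<omega>) {1..n}"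
    by (rule indep_vars_restrict[OF ind]) (auto simp: row_def I_def disjoint_family_on_def)
  have B: "{r \<in> PiE (row i) (\<lambda>_. UNIV). int p dvd (\<Sum>j=1..i. r (i, j) * v j)}
      \<in> sets (PiM (row i) (\<lambda>_. count_space UNIV))" for i v
    by (auto simp: PiM_count_space_UNIV_int row_def)
  have vimage: "(\<lambda>\<omega>. \<lambda>k\<in>row i. X k \<omega>) -` {r \<in> PiE (row i) (\<lambda>_. UNIV). int p dvd (\<Sum>j=1..i. r (i, j) * v j)} \<inter> space N
      = {\<omega> \<in> space N. int p dvd 0 - (\<Sum>j=1..i. X (i, j) \<omega> * v j)}" for i v
    by (auto simp: row_def)
  have prob_kernel: "prob (kernel v) = vec_prob n v" for v
  proof -
    have "prob (kernel v) = (\<Prod>i\<in>{1..n}. prob ((\<lambda>\<omega>. \<lambda>k\<in>row i. X k \<omega>) -`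
        {r \<in> PiE (row i) (\<lambda>_. UNIV). int p dvd (\<Sum>j=1..i. r (i, j) * v j)} \<inter> space N))"
      unfolding kernel_def using n by (intro indep_varsD_finite[OF rows] B) auto
    also have "\<dots> = vec_prob n v"
      unfolding vec_prob_def vimage
    proof (rule prod.cong[OF refl])
      fix i assume "i \<in> {1..n}"
      then show "prob {\<omega> \<in> space N. int p dvd 0 - (\<Sum>j=1..i. X (i, j) \<omega> * v j)} = row_prob i v 0"
        by (intro prob_row_sum_eq_row_prob[OF N ind law]) (auto simp: inj_on_def I_def)
    qed
    finally show ?thesis .
  qed
  have ev: "kernel v \<in> events" for v
    unfolding kernel_def using n rows
    by (intro sets.finite_INT measurable_sets[OF _ B]) (auto simp: indep_vars_def)
  have zero: "\<zero>\<^bsub>residue_ring (int p)\<^esub> = 0" by (simp add: residue_ring_def)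
  have fin: "finite {v. v \<in> Fp_vecs p n \<and> v 1 \<noteq> 0}"
    by (rule finite_subset[OF _ finite_Fp_vecs[of p n]]) auto
  have "real (card {v \<in> Fp_vecs p n. v 1 \<noteq> \<zero>\<^bsub>residue_ring (int p)\<^esub> \<and>
        Fp_mat_vec p n (L \<omega>) v = Fp_zero_vec p n})
      = (\<Sum>v | v \<in> Fp_vecs p n \<and> v 1 \<noteq> 0. indicator (kernel v) \<omega>)" if \<omega>: "\<omega> \<in> space N" for \<omega>
  proof -
    have "Fp_mat_vec p n (L \<omega>) v = Fp_zero_vec p n \<longleftrightarrow> \<omega> \<in> kernel v" for v
      unfolding kernel_def vimage
      using n \<omega> by (subst Fp_mat_vec_eq_zero_iff[OF p_gt_1 tri[OF \<omega>]]) (auto simp: X_def)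
    then have "{v \<in> Fp_vecs p n. v 1 \<noteq> \<zero>\<^bsub>residue_ring (int p)\<^esub> \<and>
        Fp_mat_vec p n (L \<omega>) v = Fp_zero_vec p n} = {v. v \<in> Fp_vecs p n \<and> v 1 \<noteq> 0} \<inter> {v. \<omega> \<in> kernel v}"
      by (auto simp: zero)
    then show ?thesis
      using fin by (simp add: indicator_def sum.If_cases)
  qed
  then have "(\<integral>\<omega>. real (card {v \<in> Fp_vecs p n. v 1 \<noteq> \<zero>\<^bsub>residue_ring (int p)\<^esub> \<and>
        Fp_mat_vec p n (L \<omega>) v = Fp_zero_vec p n}) \<partial>N)
      = (\<integral>\<omega>. (\<Sum>v | v \<in> Fp_vecs p n \<and> v 1 \<noteq> 0. indicator (kernel v) \<omega>) \<partial>N)"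
    by (intro Bochner_Integration.integral_cong) auto
  also have "\<dots> = (\<Sum>v | v \<in> Fp_vecs p n \<and> v 1 \<noteq> 0. \<integral>\<omega>. indicator (kernel v) \<omega> \<partial>N)"
    using ev by (intro Bochner_Integration.integral_sum) (auto simp: integrable_indicator_iff emeasure_eq_measure)
  also have "\<dots> = (\<Sum>v | v \<in> Fp_vecs p n \<and> v 1 \<noteq> 0. vec_prob n v)"
    using ev by (simp flip: prob_kernel add: sets.Int_space_eq2)
  finally show ?thesis .
qed

theorem lemma2:
  fixes p :: nat
    and M :: "'a measure" and \<xi> :: "'a \<Rightarrow> int"
    and N :: "nat \<Rightarrow> 'b measure" and L :: "nat \<Rightarrow> 'b \<Rightarrow> nat \<Rightarrow> nat \<Rightarrow> int"
  assumes "prime p"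
    and "prob_space M" and "\<xi> \<in> measurable M (count_space UNIV)"
    and "0 < measure M {\<omega> \<in> space M. int p dvd \<xi> \<omega>}"
    and "measure M {\<omega> \<in> space M. int p dvd \<xi> \<omega>} < 1"
    and "\<And>n. n \<ge> 1 \<Longrightarrow> prob_space (N n)"
    and "\<And>n. n \<ge> 1 \<Longrightarrow>
           iid_lower_triangular (N n) (distr M (count_space UNIV) \<xi>) n (L n)"
  shows "\<exists>\<chi>\<^sub>0::real.
    (\<lambda>n. \<integral>\<omega>. real (card {v \<in> Fp_vecs p n. v 1 \<noteq> \<zero>\<^bsub>residue_ring (int p)\<^esub> \<and>
                             Fp_mat_vec p n (L n \<omega>) v = Fp_zero_vec p n}) \<partial>(N n))
      \<longlonglongrightarrow> \<chi>\<^sub>0 \<and> 0 < \<chi>\<^sub>0"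
proof -
  interpret M: prob_space M by (rule assms(2))
  define D where "D = distr M (count_space UNIV) \<xi>"
  interpret D: prob_space D
    unfolding D_def by (rule M.prob_space_distr[OF assms(3)])
  have D_sets [simp]: "sets D = UNIV" "space D = UNIV" by (simp_all add: D_def)
  define \<mu> where "\<mu> a = measure D {x. x mod int p = a}" for a
  have p: "1 < p" using assms(1) prime_gt_1_nat by blast
  have "\<mu> 0 = measure M (\<xi> -` {x. x mod int p = 0} \<inter> space M)"
    unfolding \<mu>_def D_def using assms(3) by (intro measure_distr) auto
  also have "\<xi> -` {x. x mod int p = 0} \<inter> space M = {\<omega> \<in> space M. int p dvd \<xi> \<omega>}"
    by (auto simp: dvd_eq_mod_eq_0)
  finally have mu0: "\<mu> 0 = measure M {\<omega> \<in> space M. int p dvd \<xi> \<omega>}" .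
  have "(\<Sum>a\<in>{0..<int p}. \<mu> a) = measure D (\<Union>a\<in>{0..<int p}. {x. x mod int p = a})"
    unfolding \<mu>_def
    by (intro D.finite_measure_finite_Union[symmetric]) (auto simp: disjoint_family_on_def)
  also have "(\<Union>a\<in>{0..<int p}. {x. x mod int p = a}) = space D" using p by auto
  finally have sum1: "(\<Sum>a\<in>{0..<int p}. \<mu> a) = 1" by (simp only: D.prob_space)
  interpret residue_distribution p \<mu>
    using assms(1,4,5) mu0 sum1 by unfold_locales (auto simp: \<mu>_def)
  obtain \<chi>\<^sub>0 where \<chi>: "0 < \<chi>\<^sub>0"
    "(\<lambda>n. \<Sum>v | v \<in> Fp_vecs p n \<and> v 1 \<noteq> 0. vec_prob n v) \<longlonglongrightarrow> \<chi>\<^sub>0"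
    using sum_vec_prob_converges by blast
  have "eventually (\<lambda>n. (\<Sum>v | v \<in> Fp_vecs p n \<and> v 1 \<noteq> 0. vec_prob n v) =
      (\<integral>\<omega>. real (card {v \<in> Fp_vecs p n. v 1 \<noteq> \<zero>\<^bsub>residue_ring (int p)\<^esub> \<and>
         Fp_mat_vec p n (L n \<omega>) v = Fp_zero_vec p n}) \<partial>(N n))) sequentially"
    using eventually_ge_at_top[of 1]
  proof eventually_elim
    case (elim n)
    show ?case
      by (rule expected_kernel_card[symmetric, where D = D])
        (use elim assms(6,7) in \<open>auto simp: D_def[symmetric] \<mu>_def[symmetric]\<close>)
  qed
  from Lim_transform_eventually[OF \<chi>(2) this] \<chi>(1) show ?thesis by blast
qed

end
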